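(* Let $F:\mathbb{T}^d\to\mathbb{T}^d$ be a continuous torus map whose winding matrix $M$ has an integer eigenvalue $m$. Then $F$ is semi-conjugate to the circle map $x\mapsto mx\bmod 1$ on $S^1=\mathbb{R}/\mathbb{Z}$, i.e., there is a semi-conjugacy map $\Phi:\mathbb{T}^d\to S^1$ such that $\Phi(F(z))=m\,\Phi(z)\bmod 1$ for all $z\in\mathbb{T}^d$.
   Context: $\mathbb{T}^d=\mathbb{R}^d/\mathbb{Z}^d$. Every continuous map $F:\mathbb{T}^d\to\mathbb{T}^d$ can be written as $F(z\bmod 1)=Mz+G(z)\bmod 1$ with $M$ a unique $d\times d$ integer matrix, called the winding matrix of $F$ (equivalently, the matrix of the induced map on $H_1(\mathbb{T}^d)$), and $G:\mathbb{R}^d\to\mathbb{R}^d$ bounded, continuous and $1$-periodic ($G(z+\vec n)=G(z)$ for all $\vec n\in\mathbb{Z}^d$). A map $F:X\to X$ is semi-conjugate to $T:Y\to Y$ if there is a continuous onto map $\Phi:X\to Y$ (the semi-conjugacy) with $\Phi\circ F=T\circ\Phi$.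
   Formalization: The integer eigenvalue m is assumed to satisfy |m| > 1; for m = 0, 1, -1 the claim fails in general, e.g. for m = 1 an irrational rotation of the circle has only constant maps Φ with Φ(F(z)) = Φ(z), which are not onto. *)

theory Defs
  imports "HOL-Analysis.Analysis"
begin

text \<open>
  The torus is the quotient of a Euclidean space by the lattice of vectors all of whose coordinates
  are integers. The type \<open>(real^'n) torus\<close> is \<open>\<real>\<^sup>d/\<int>\<^sup>d\<close> with \<open>d = CARD('n)\<close>, and \<open>real torus\<close> is
  the circle \<open>\<real>/\<int>\<close>.
\<close>

definition lattice_eq :: "'a::euclidean_space \<Rightarrow> 'a \<Rightarrow> bool" where
  "lattice_eq x y \<longleftrightarrow> (\<forall>b\<in>Basis. (x - y) \<bullet> b \<in> \<int>)"

lemma equivp_lattice_eq: "equivp (lattice_eq :: 'a::euclidean_space \<Rightarrow> 'a \<Rightarrow> bool)"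
proof (rule equivpI)
  show "reflp (lattice_eq :: 'a \<Rightarrow> 'a \<Rightarrow> bool)"
    by (simp add: reflp_def lattice_eq_def)
  show "symp (lattice_eq :: 'a \<Rightarrow> 'a \<Rightarrow> bool)"
  proof (rule sympI)
    fix x y :: 'a assume "lattice_eq x y"
    then show "lattice_eq y x"
      unfolding lattice_eq_def by (metis Ints_minus inner_minus_left minus_diff_eq)
  qed
  show "transp (lattice_eq :: 'a \<Rightarrow> 'a \<Rightarrow> bool)"
  proof (rule transpI)
    fix x y z :: 'a assume *: "lattice_eq x y" "lattice_eq y z"
    have "(x - z) \<bullet> b = (x - y) \<bullet> b + (y - z) \<bullet> b" for b
      by (simp add: inner_diff_left)
    with * show "lattice_eq x z"
      unfolding lattice_eq_def by (metis Ints_add)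
  qed
qed

quotient_type (overloaded) 'a torus = "'a::euclidean_space" / lattice_eq
  morphisms rep_torus mod1
  by (rule equivp_lattice_eq)

lemma mod1_eq_iff: "mod1 x = mod1 y \<longleftrightarrow> lattice_eq x y"
  by (rule torus.abs_eq_iff)

lemma mod1_vec_eq_iff:
  fixes x y :: "real^'n"
  shows "mod1 x = mod1 y \<longleftrightarrow> (\<forall>i. x $ i - y $ i \<in> \<int>)"
  by (auto simp: mod1_eq_iff lattice_eq_def Basis_vec_def inner_axis)

lemma mod1_real_eq_iff:
  fixes x y :: real
  shows "mod1 x = mod1 y \<longleftrightarrow> x - y \<in> \<int>"
  by (simp add: mod1_eq_iff lattice_eq_def)

instantiation torus :: (euclidean_space) topological_space
begin

text \<open>The quotient topology.\<close>

definition open_torus :: "'a torus set \<Rightarrow> bool" where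
  "open_torus U \<longleftrightarrow> open (mod1 -` U)"

instance
proof
  show "open (UNIV :: 'a torus set)"
    by (simp add: open_torus_def)
  show "open (S \<inter> T)" if "open S" "open T" for S T :: "'a torus set"
    using that by (simp add: open_torus_def open_Int)
  show "open (\<Union>K)" if "\<forall>S\<in>K. open S" for K :: "'a torus set set"
    using that by (auto simp: open_torus_def vimage_Union)
qed

end

text \<open>
  A relation rather than a function of \<open>F\<close>; for continuous \<open>F\<close> exactly one \<open>M\<close> satisfies it.
\<close>

definition winding_matrix ::
    "((real^'n) torus \<Rightarrow> (real^'n) torus) \<Rightarrow> int^'n^'n \<Rightarrow> bool" where
  "winding_matrix F M \<longleftrightarrow>
     (\<exists>G :: real^'n \<Rightarrow> real^'n.
        bounded (range G) \<and> continuous_on UNIV G \<and>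
        (\<forall>z n. (\<forall>i. n $ i \<in> \<int>) \<longrightarrow> G (z + n) = G z) \<and>
        (\<forall>z. F (mod1 z) = mod1 (map_matrix real_of_int M *v z + G z)))"

definition eigenvalue :: "real^'n^'n \<Rightarrow> real \<Rightarrow> bool" where
  "eigenvalue A c \<longleftrightarrow> (\<exists>v. v \<noteq> 0 \<and> A *v v = c *s v)"

lift_definition circle_map :: "int \<Rightarrow> real torus \<Rightarrow> real torus"
  is "\<lambda>m x. real_of_int m * x"
proof -
  fix m :: int and x y :: real
  assume "lattice_eq x y"
  then have "real_of_int m * (x - y) \<in> \<int>"
    by (simp add: lattice_eq_def)
  then show "lattice_eq (real_of_int m * x) (real_of_int m * y)"
    by (simp add: lattice_eq_def right_diff_distrib)
qed

definition semiconjugacy ::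
    "('a::topological_space \<Rightarrow> 'b::topological_space) \<Rightarrow> ('a \<Rightarrow> 'a) \<Rightarrow> ('b \<Rightarrow> 'b) \<Rightarrow> bool" where
  "semiconjugacy \<Phi> F T \<longleftrightarrow> continuous_on UNIV \<Phi> \<and> surj \<Phi> \<and> \<Phi> \<circ> F = T \<circ> \<Phi>"

end

theory Submission
  imports Defs
begin

text \<open>
  The matrix \<open>M - m I\<close> has integer entries, so its determinant is the same number over \<open>\<int>\<close>, \<open>\<rat>\<close>
  and \<open>\<real>\<close>. It vanishes because \<open>m\<close> is an eigenvalue; hence its transpose has a rational, and after
  clearing denominators an integral, kernel vector \<open>w \<noteq> 0\<close>
  (\<open>integer_left_eigenvector\<close>). The linear functional \<open>z \<mapsto> w \<bullet> z\<close> then descends to a map from the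
  torus onto the circle that semi-conjugates the linear torus map \<open>M\<close> to multiplication by \<open>m\<close>.

  For the lift \<open>f z = M z + G z\<close> of \<open>F\<close> the functional satisfies \<open>w \<bullet> f z = m (w \<bullet> z) + w \<bullet> G z\<close>, an
  error that is bounded and periodic. Adding a correction \<open>g\<close> repairs it exactly when
  \<open>m g = w \<bullet> G + g \<circ> f\<close>. As \<open>\<bar>m\<bar> > 1\<close>, this equation is solved by iterating
  \<open>g = (w \<bullet> G + g \<circ> f) / m\<close>, which gives the geometrically convergent series
  \<open>g = (\<Sum>k. (w \<bullet> G \<circ> f\<^sup>k) / m\<^sup>k\<^sup>+\<^sup>1)\<close>. Uniform convergence makes \<open>g\<close> continuous. It is periodic because
  \<open>f\<close>, as a lift of a torus map, sends points that differ by a lattice vector to points that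
  differ by a lattice vector. So \<open>\<phi> z = w \<bullet> z + g z\<close> descends to a continuous map of
  the torus to the circle with the required equivariance. Finally \<open>\<phi>\<close> increases by the integer
  \<open>w \<bullet> w \<ge> 1\<close> when its argument is moved by \<open>w\<close>, so by the intermediate value theorem it meets every
  class modulo 1.
\<close>

section \<open>Integral left eigenvectors\<close>

lemma common_denominator:
  fixes q :: "rat^'n"
  obtains N :: int and w :: "int^'n"
  where "N > 0" and "\<And>i. rat_of_int (w $ i) = rat_of_int N * q $ i"
proof -
  define d where "d i = snd (quotient_of (q $ i))" for i
  define N where "N = (\<Prod>i\<in>UNIV. d i)"
  have d_pos: "d i > 0" for i
    by (simp add: d_def quotient_of_denom_pos')
  have "\<exists>a. rat_of_int a = rat_of_int N * q $ i" for i
  proof -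
    obtain b where "q $ i = rat_of_int b / rat_of_int (d i)"
      by (metis d_def prod.collapse quotient_of_div)
    moreover obtain e where "N = d i * e"
      unfolding N_def by (metis dvdE dvd_prodI finite UNIV_I)
    ultimately have "rat_of_int N * q $ i = rat_of_int (e * b)"
      using d_pos[of i] by simp
    then show ?thesis by metis
  qed
  then obtain a where "\<And>i. rat_of_int (a i) = rat_of_int N * q $ i" by metis
  then show ?thesis
    using that[of N "\<chi> i. a i"] d_pos by (simp add: N_def prod_pos)
qed

lemma det_map_matrix_of_int:
  fixes A :: "int^'n^'n"
  shows "det (map_matrix of_int A :: 'a::comm_ring_1^'n^'n) = of_int (det A)"
  by (simp add: det_def)

text \<open>
  Over a field a singular matrix has a kernel vector; over \<open>\<int>\<close> one goes through \<open>\<rat>\<close> and multiplies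
  by a common denominator.
\<close>

lemma singular_integer_matrix_kernel:
  fixes A :: "int^'n^'n"
  assumes "det A = 0"
  obtains w :: "int^'n" where "w \<noteq> 0" and "A *v w = 0"
proof -
  let ?Q = "map_matrix rat_of_int A"
  have "det ?Q = 0"
    by (simp add: det_map_matrix_of_int assms)
  then obtain q where q: "?Q *v q = 0" "q \<noteq> 0"
    using invertible_det_nz invertible_left_inverse matrix_left_invertible_ker by metis
  obtain N w where N: "N > 0" and w: "\<And>i. rat_of_int (w $ i) = rat_of_int N * q $ i"
    using common_denominator by blast
  have "w \<noteq> 0"
  proof
    assume "w = 0"
    with w N have "q $ i = 0" for i
      by (metis mult_eq_0_iff of_int_0 of_int_eq_0_iff less_irrefl zero_index)
    with q show False by (simp add: vec_eq_iff)
  qed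
  moreover have "A *v w = 0"
  proof -
    have "rat_of_int ((A *v w) $ i) = rat_of_int N * (?Q *v q) $ i" for i
      by (simp add: matrix_vector_mult_def w sum_distrib_left mult_ac)
    with q show ?thesis by (simp add: vec_eq_iff)
  qed
  ultimately show ?thesis using that by blast
qed

text \<open>
  The eigenvector condition is stated in dual form, as an identity for the functional
  \<open>x \<mapsto> w \<bullet> x\<close>: this is the form in which it acts on a lifted torus map.
\<close>

lemma integer_left_eigenvector:
  fixes M :: "int^'n^'n" and m :: int
  assumes "eigenvalue (map_matrix real_of_int M) (real_of_int m)"
  obtains w :: "real^'n" where "w \<noteq> 0" and "\<And>i. w $ i \<in> \<int>"
    and "\<And>x. w \<bullet> (map_matrix real_of_int M *v x) = real_of_int m * (w \<bullet> x)"
proof -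
  define B where "B = M - mat m"
  have B_mult: "map_matrix real_of_int B *v x
      = map_matrix real_of_int M *v x - real_of_int m *s x" for x
  proof -
    have "map_matrix real_of_int B = map_matrix real_of_int M - mat (real_of_int m)"
      by (simp add: B_def vec_eq_iff mat_def)
    moreover have "mat (real_of_int m) *v x = real_of_int m *s x"
      by (simp add: vec_eq_iff matrix_vector_mult_def mat_def if_distrib[of "\<lambda>a. a * _"] cong: if_cong)
    ultimately show ?thesis by (simp add: matrix_vector_mult_diff_rdistrib)
  qed
  obtain v where "v \<noteq> 0" "map_matrix real_of_int B *v v = 0"
    using assms by (auto simp: eigenvalue_def B_mult)
  then have "det (map_matrix real_of_int B) = 0"
    using invertible_det_nz invertible_left_inverse matrix_left_invertible_ker by metis
  then have "det (transpose B) = 0"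
    by (simp add: det_map_matrix_of_int)
  then obtain u where u: "u \<noteq> 0" "transpose B *v u = 0"
    using singular_integer_matrix_kernel by blast
  define w where "w = (\<chi> i. real_of_int (u $ i))"
  have "w v* map_matrix real_of_int B = 0"
  proof -
    have "(w v* map_matrix real_of_int B) $ i = real_of_int ((transpose B *v u) $ i)" for i
      by (simp add: w_def vector_matrix_mult_def matrix_vector_mult_def transpose_def mult_ac)
    with u show ?thesis by (simp add: vec_eq_iff)
  qed
  then have "w \<bullet> (map_matrix real_of_int B *v x) = 0" for x
    by (metis dot_lmul_matrix inner_zero_left)
  then have "w \<bullet> (map_matrix real_of_int M *v x) = real_of_int m * (w \<bullet> x)" for x
    by (simp add: B_mult inner_diff_right scalar_mult_eq_scaleR)
  moreover have "w \<noteq> 0" using u by (simp add: w_def vec_eq_iff)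
  ultimately show ?thesis using that[of w] by (simp add: w_def)
qed

section \<open>A cohomological equation over an arbitrary map\<close>

text \<open>
  The series obtained by iterating \<open>g = (c + g \<circ> f) / m\<close>, starting from \<open>0\<close>; for bounded \<open>c\<close> and
  \<open>\<bar>m\<bar> > 1\<close> it solves this equation.
\<close>

definition discounted_orbit_sum :: "real \<Rightarrow> ('a \<Rightarrow> 'a) \<Rightarrow> ('a \<Rightarrow> real) \<Rightarrow> 'a \<Rightarrow> real" where
  "discounted_orbit_sum m f c z = (\<Sum>k. c ((f ^^ k) z) / m ^ Suc k)"

context
  fixes m C :: real and c :: "'a \<Rightarrow> real"
  assumes m: "\<bar>m\<bar> > 1" and C: "\<And>z. \<bar>c z\<bar> \<le> C"
begin

lemma discounted_term_bound: "norm (c z / m ^ Suc k) \<le> C / \<bar>m\<bar> * (1 / \<bar>m\<bar>) ^ k"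
proof -
  have "norm (c z / m ^ Suc k) = \<bar>c z\<bar> / \<bar>m\<bar> ^ Suc k"
    by (simp add: abs_mult power_abs)
  also have "\<dots> \<le> C / \<bar>m\<bar> ^ Suc k"
    by (intro divide_right_mono C) auto
  finally show ?thesis by (simp add: power_divide)
qed

lemma summable_discounted_bound: "summable (\<lambda>k. C / \<bar>m\<bar> * (1 / \<bar>m\<bar>) ^ k)"
  using m by (intro summable_mult summable_geometric) simp

lemma discounted_orbit_sum_equation:
  "m * discounted_orbit_sum m f c z = c z + discounted_orbit_sum m f c (f z)"
proof -
  let ?a = "\<lambda>k. c ((f ^^ k) z) / m ^ Suc k"
  have "summable ?a"
    by (rule summable_comparison_test'[OF summable_discounted_bound discounted_term_bound])
  then have "discounted_orbit_sum m f c z = ?a 0 + (\<Sum>k. ?a (Suc k))"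
    using suminf_split_head[of ?a] unfolding discounted_orbit_sum_def by linarith
  moreover have "m * (\<Sum>k. ?a (Suc k)) = (\<Sum>k. m * ?a (Suc k))"
    using \<open>summable ?a\<close> summable_Suc_iff[of ?a] by (intro suminf_mult[symmetric]) blast
  moreover have "m * ?a (Suc k) = c ((f ^^ k) (f z)) / m ^ Suc k" for k
    using m by (simp add: funpow_swap1)
  moreover have "m * ?a 0 = c z" using m by auto
  ultimately show ?thesis
    by (simp only: discounted_orbit_sum_def distrib_left)
qed

end

text \<open>The geometric bound on the terms does not depend on the point, so the series converges uniformly.\<close>

lemma continuous_on_discounted_orbit_sum:
  fixes f :: "'a::topological_space \<Rightarrow> 'a"
  assumes "\<bar>m\<bar> > 1" and "\<And>z. \<bar>c z\<bar> \<le> C"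
    and f: "continuous_on UNIV f" and c: "continuous_on UNIV c"
  shows "continuous_on UNIV (discounted_orbit_sum m f c)"
proof -
  have iter: "continuous_on UNIV (f ^^ k)" for k
    by (induction k) (auto intro: continuous_on_compose2[OF f])
  have "continuous_on UNIV (\<lambda>z. \<Sum>k<n. c ((f ^^ k) z) / m ^ Suc k)" for n
    using assms(1)
    by (intro continuous_intros continuous_on_compose2[OF c iter]) auto
  moreover have "uniform_limit UNIV (\<lambda>n z. \<Sum>k<n. c ((f ^^ k) z) / m ^ Suc k)
      (\<lambda>z. \<Sum>k. c ((f ^^ k) z) / m ^ Suc k) sequentially"
    by (rule Weierstrass_m_test[OF discounted_term_bound summable_discounted_bound])
      (use assms in auto)
  ultimately have "continuous_on UNIV (\<lambda>z. \<Sum>k. c ((f ^^ k) z) / m ^ Suc k)"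
    by (intro uniform_limit_theorem[OF always_eventually]) auto
  then show ?thesis
    by (simp add: discounted_orbit_sum_def[abs_def])
qed

section \<open>From the lattice cover to the torus\<close>

lemma inner_integral_vectors:
  fixes v w :: "real^'n"
  assumes "\<And>i. v $ i \<in> \<int>" and "\<And>i. w $ i \<in> \<int>"
  shows "v \<bullet> w \<in> \<int>"
  using assms by (auto simp: inner_vec_def intro!: Ints_sum Ints_mult)

lemma lattice_eq_vec_iff:
  fixes x y :: "real^'n"
  shows "lattice_eq x y \<longleftrightarrow> (\<forall>i. x $ i - y $ i \<in> \<int>)"
  using mod1_vec_eq_iff mod1_eq_iff by metis

lemma mod1_rep_torus [simp]: "mod1 (rep_torus t) = t"
  using Quotient_abs_rep[OF Quotient_torus] .

text \<open>
  Continuity passes to the quotient because a set is open in the quotient topology exactly when its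
  preimage is open.
\<close>

lemma continuous_on_torus_descend:
  fixes \<phi> :: "'a::euclidean_space \<Rightarrow> 'b::euclidean_space"
  assumes "continuous_on UNIV \<phi>" and "\<And>z. \<Phi> (mod1 z) = mod1 (\<phi> z)"
  shows "continuous_on UNIV \<Phi>"
proof -
  have "open (\<Phi> -` U)" if "open U" for U
  proof -
    have "mod1 -` (\<Phi> -` U) = \<phi> -` (mod1 -` U)"
      by (auto simp: assms(2))
    moreover have "open (\<phi> -` (mod1 -` U))"
      using that assms(1) by (auto simp: open_torus_def intro: open_vimage)
    ultimately show ?thesis by (simp add: open_torus_def)
  qed
  then show ?thesis by (simp add: continuous_on_open_vimage)
qed

lemma real_mod1_surj:
  fixes \<phi> :: "'a::real_normed_vector \<Rightarrow> real"
  assumes "continuous_on UNIV \<phi>" and "\<phi> a + 1 \<le> \<phi> b"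
  shows "\<exists>z. mod1 (\<phi> z) = t"
proof -
  define x where "x = rep_torus t"
  \<comment> \<open>The representative of \<open>t\<close> in \<open>[\<phi> a, \<phi> a + 1)\<close>.\<close>
  define y where "y = x + of_int \<lceil>\<phi> a - x\<rceil>"
  have "connected (range \<phi>)"
    using assms(1) by (intro connected_continuous_image) auto
  moreover have "\<phi> a \<le> y" "y \<le> \<phi> b"
    using assms(2) unfolding y_def by linarith+
  ultimately have "y \<in> range \<phi>"
    by (meson connectedD_interval rangeI)
  moreover have "mod1 y = t"
    by (metis Ints_of_int add_diff_cancel_left' mod1_real_eq_iff mod1_rep_torus x_def y_def)
  ultimately show ?thesis by blast
qed

section \<open>The semi-conjugacy to a circle map\<close>

theorem corollary1p2:
  fixes F :: "(real^'n) torus \<Rightarrow> (real^'n) torus"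
    and M :: "int^'n^'n"
    and m :: int
  assumes "continuous_on UNIV F"
    and "winding_matrix F M"
    and "eigenvalue (map_matrix real_of_int M) (real_of_int m)"
    and "\<bar>m\<bar> > 1"
  shows "\<exists>\<Phi> :: (real^'n) torus \<Rightarrow> real torus. semiconjugacy \<Phi> F (circle_map m)"
proof -
  let ?M = "map_matrix real_of_int M"
  obtain G :: "real^'n \<Rightarrow> real^'n" where bounded_G: "bounded (range G)"
    and cont_G: "continuous_on UNIV G"
    and periodic_G: "\<And>z n. (\<forall>i. n $ i \<in> \<int>) \<Longrightarrow> G (z + n) = G z"
    and F_mod1: "\<And>z. F (mod1 z) = mod1 (?M *v z + G z)"
    using assms(2) unfolding winding_matrix_def by blast
  obtain w :: "real^'n" where w: "w \<noteq> 0" "\<And>i. w $ i \<in> \<int>"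
    and eig: "\<And>x. w \<bullet> (?M *v x) = real_of_int m * (w \<bullet> x)"
    using integer_left_eigenvector[OF assms(3)] by blast
  have m: "\<bar>real_of_int m\<bar> > 1" using assms(4) by linarith
  define f where "f z = ?M *v z + G z" for z
  define c where "c z = w \<bullet> G z" for z
  define g where "g = discounted_orbit_sum (real_of_int m) f c"
  define \<phi> where "\<phi> z = w \<bullet> z + g z" for z

  have G_lattice: "G x = G y" if "lattice_eq x y" for x y
    using periodic_G[of "x - y" y] that by (simp add: lattice_eq_vec_iff)
  \<comment> \<open>Both values of \<open>f\<close> represent the same point of the torus, the image of \<open>mod1 x\<close> under \<open>F\<close>.\<close>
  have f_lattice: "lattice_eq (f x) (f y)" if "lattice_eq x y" for x y
    using that G_lattice[OF that] mod1_eq_iff F_mod1 by (metis f_def)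
  have c_orbit: "c ((f ^^ k) x) = c ((f ^^ k) y)" if "lattice_eq x y" for k x y
  proof -
    have "lattice_eq ((f ^^ k) x) ((f ^^ k) y)"
      using that by (induction k) (auto intro: f_lattice)
    then show ?thesis by (simp add: c_def G_lattice)
  qed
  have g_lattice: "g x = g y" if "lattice_eq x y" for x y
    by (simp add: g_def discounted_orbit_sum_def c_orbit[OF that])

  obtain K where K: "\<And>z. norm (G z) \<le> K"
    using bounded_G by (auto simp: bounded_iff)
  have c_bound: "\<bar>c z\<bar> \<le> norm w * K" for z
    unfolding c_def using Cauchy_Schwarz_ineq2[of w "G z"] mult_left_mono[OF K[of z], of "norm w"]
    by simp
  have "continuous_on UNIV f"
    unfolding f_def by (intro continuous_intros cont_G matrix_vector_mult_linear_continuous_on)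
  moreover have "continuous_on UNIV c"
    unfolding c_def by (intro continuous_intros cont_G)
  ultimately have "continuous_on UNIV g"
    unfolding g_def by (rule continuous_on_discounted_orbit_sum[OF m c_bound])
  then have cont_\<phi>: "continuous_on UNIV \<phi>"
    unfolding \<phi>_def by (intro continuous_intros)

  have \<phi>_f: "\<phi> (f z) = real_of_int m * \<phi> z" for z
  proof -
    have "real_of_int m * g z = c z + g (f z)"
      unfolding g_def by (rule discounted_orbit_sum_equation[OF m c_bound])
    moreover have "w \<bullet> f z = real_of_int m * (w \<bullet> z) + c z"
      by (simp add: f_def c_def inner_add_right eig)
    ultimately show ?thesis by (simp add: \<phi>_def algebra_simps)
  qed
  have \<phi>_lattice: "mod1 (\<phi> x) = mod1 (\<phi> y)" if "lattice_eq x y" for x y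
  proof -
    have "\<phi> x - \<phi> y = w \<bullet> (x - y)"
      using g_lattice[OF that] by (simp add: \<phi>_def inner_diff_right)
    also have "\<dots> \<in> \<int>"
      using that w by (intro inner_integral_vectors) (auto simp: lattice_eq_vec_iff)
    finally show ?thesis by (simp add: mod1_real_eq_iff)
  qed

  define \<Phi> where "\<Phi> t = mod1 (\<phi> (rep_torus t))" for t
  have \<Phi>_mod1: "\<Phi> (mod1 z) = mod1 (\<phi> z)" for z
    unfolding \<Phi>_def by (rule \<phi>_lattice) (simp flip: mod1_eq_iff)
  have "continuous_on UNIV \<Phi>"
    using cont_\<phi> \<Phi>_mod1 by (rule continuous_on_torus_descend)
  moreover have "surj \<Phi>"
  proof -
    obtain k where k: "w \<bullet> w = real_of_int k"
      using w inner_integral_vectors Ints_cases by metis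
    have "real_of_int k > 0"
      using w k inner_gt_zero_iff by metis
    then have "1 \<le> w \<bullet> w"
      unfolding k by simp
    moreover have "g w = g 0"
      using w by (intro g_lattice) (simp add: lattice_eq_vec_iff)
    ultimately have "\<phi> 0 + 1 \<le> \<phi> w"
      by (simp add: \<phi>_def)
    then have "\<exists>z. mod1 (\<phi> z) = t" for t
      by (rule real_mod1_surj[OF cont_\<phi>])
    then show ?thesis
      by (metis \<Phi>_mod1 surjI surj_def)
  qed
  moreover have "\<Phi> \<circ> F = circle_map m \<circ> \<Phi>"
  proof
    fix t :: "(real^'n) torus"
    define z where "z = rep_torus t"
    have t: "t = mod1 z" by (simp add: z_def)
    have "\<Phi> (F t) = mod1 (\<phi> (f z))"
      by (simp add: t F_mod1 \<Phi>_mod1 flip: f_def)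
    also have "\<dots> = circle_map m (\<Phi> t)"
      by (simp add: t \<Phi>_mod1 \<phi>_f circle_map.abs_eq)
    finally show "(\<Phi> \<circ> F) t = (circle_map m \<circ> \<Phi>) t" by simp
  qed
  ultimately show ?thesis
    unfolding semiconjugacy_def by blast
qed

end
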